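(* Let $\{a_n\}$ be a sequence of real numbers, and let $E = \{x \in \mathbb{R} : \text{the set of fractional parts } \{\langle x a_n \rangle\} \text{ is not dense in } [0,1)\}$. If the packing dimension of $E$ satisfies $\dim_P(E) < 1/2$, then for each $\epsilon \in (0,1]$, there exists a $(1-\epsilon)$-large set $S \subset \mathbb{R}$ that does not contain any affine copy of $\{a_n\}$.
   Context: For a real number $y$, $\langle y \rangle = y - \lfloor y \rfloor \in [0,1)$ denotes its fractional part. $|A|$ denotes the Lebesgue measure of a measurable set $A \subseteq \mathbb{R}$. For $\epsilon \in (0,1]$, a $(1-\epsilon)$-large set is a Lebesgue measurable set $S \subseteq \mathbb{R}$ such that $|S \cap I| \geq 1-\epsilon$ for every interval $I \subset \mathbb{R}$ of unit length. An affine copy of $\{a_n\}$ is a set of the form $x\{a_n\} + t = \{x a_n + t\}$ (over all indices $n$) with $x \in \mathbb{R} \setminus \{0\}$ and $t \in \mathbb{R}$. Packing dimension $\dim_P$ is the standard one from fractal geometry. *)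

theory Defs
  imports "HOL-Analysis.Analysis"
begin

text \<open>
  Packing measures and packing dimension, following Tricot. A packing is encoded by the pairs
  (centre, radius) of its balls; all radii are positive, so \<open>(2 * r) powr s\<close> is the
  \<open>s\<close>-th power of the diameter, and it equals 1 for \<open>s = 0\<close>.
\<close>

definition is_packing :: "real \<Rightarrow> 'a::euclidean_space set \<Rightarrow> ('a \<times> real) set \<Rightarrow> bool" where
  "is_packing \<delta> A P \<longleftrightarrow> countable P \<and>
     (\<forall>(x, r) \<in> P. x \<in> A \<and> 0 < r \<and> r \<le> \<delta>) \<and>
     disjoint_family_on (\<lambda>(x, r). cball x r) P"

definition packing_premeasure_scale :: "real \<Rightarrow> real \<Rightarrow> 'a::euclidean_space set \<Rightarrow> ennreal" where
  "packing_premeasure_scale s \<delta> A =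
     (SUP P \<in> {P. is_packing \<delta> A P}. \<Sum>\<^sub>\<infinity>(x, r) \<in> P. ennreal ((2 * r) powr s))"

text \<open>
  The scale premeasure is nondecreasing in \<open>\<delta>\<close>, so its limit as \<open>\<delta>\<close> tends to 0 is an infimum.
\<close>

definition packing_premeasure :: "real \<Rightarrow> 'a::euclidean_space set \<Rightarrow> ennreal" where
  "packing_premeasure s A = (INF \<delta> \<in> {0<..}. packing_premeasure_scale s \<delta> A)"

text \<open>
  The premeasure is not countably subadditive; the packing measure is the outer measure that it
  generates. Finite covers are included, as the empty set has premeasure 0.
\<close>

definition packing_measure :: "real \<Rightarrow> 'a::euclidean_space set \<Rightarrow> ennreal" where
  "packing_measure s A =
     (INF F \<in> {F :: nat \<Rightarrow> 'a set. A \<subseteq> (\<Union>n. F n)}. \<Sum>n. packing_premeasure s (F n))"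

definition packing_dim :: "'a::euclidean_space set \<Rightarrow> ereal" where
  "packing_dim A = (INF s \<in> {s::real. 0 \<le> s \<and> packing_measure s A = 0}. ereal s)"

text \<open>
  \<open>large_set c S\<close>: \<open>S\<close> is \<open>c\<close>-large. Intervals of unit length may be open, closed or half-open.
\<close>

definition large_set :: "real \<Rightarrow> real set \<Rightarrow> bool" where
  "large_set c S \<longleftrightarrow> S \<in> sets lebesgue \<and>
     (\<forall>I. is_interval I \<and> measure lebesgue I = 1 \<longrightarrow> measure lebesgue (S \<inter> I) \<ge> c)"

definition is_affine_copy :: "(nat \<Rightarrow> real) \<Rightarrow> real set \<Rightarrow> bool" where
  "is_affine_copy a C \<longleftrightarrow> (\<exists>x t. x \<noteq> 0 \<and> C = range (\<lambda>n. x * a n + t))"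

definition non_dense_dilations :: "(nat \<Rightarrow> real) \<Rightarrow> real set" where
  "non_dense_dilations a = {x. \<not> {0..<1} \<subseteq> closure (range (\<lambda>n. frac (x * a n)))}"

end

theory Submission
  imports Defs
begin

text \<open>
  Let \<open>E\<close> be the set of \<open>x\<close> for which the fractional parts of \<open>x * a n\<close> are not dense. Remove from
  the line a comb: the short intervals of length \<open>\<mu> * \<delta>\<close> to the right of the multiples of \<open>\<mu>\<close>. If
  \<open>x / \<mu>\<close> is not in \<open>E\<close>, then every translate of the sequence \<open>x * a n\<close> hits the comb, because
  modulo \<open>\<mu>\<close> the sequence is dense. So the comb of period 1 destroys all affine copies with ratio
  outside \<open>E\<close>, and the comb of period \<open>\<mu>\<close> those with ratio outside \<open>\<mu> * E\<close>. Two combs together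
  destroy all copies as soon as \<open>E\<close> and \<open>\<mu> * E\<close> share no nonzero point, which holds whenever \<open>\<mu>\<close> is
  not a quotient of two nonzero elements of \<open>E\<close>. The combs can be as thin as desired, so the
  complement of their union is \<open>1 - \<epsilon>\<close> large.

  The dimension hypothesis provides \<open>\<mu>\<close>: morally, the quotient set is a locally Lipschitz image
  of \<open>E \<times> E\<close>, whose packing dimension is at most twice that of \<open>E\<close>, hence less than 1, and so
  it is a null set and misses some \<open>\<mu>\<close> between 0 and 1. The proof uses box counting instead of a product
  formula. For some \<open>s < 1 / 2\<close> the set \<open>E\<close> is a countable union of pieces with finite
  \<open>s\<close>-dimensional packing premeasure, and each piece is covered by \<open>O(r powr (- s))\<close>
  balls of radius \<open>2 * r\<close> (\<open>finite_premeasure_imp_covering_bound\<close>). Away from 0 and infinity, the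
  quotients of two pieces are then covered by \<open>O(r powr (- 2 * s))\<close> intervals of length
  \<open>O(r)\<close>, whose total length tends to 0 (\<open>negligible_quotients\<close>).
\<close>

section \<open>Covering numbers from the packing premeasure\<close>

lemma packing_premeasure_mono:
  assumes "A \<subseteq> B"
  shows "packing_premeasure s A \<le> packing_premeasure s B"
proof -
  have "is_packing \<delta> A P \<Longrightarrow> is_packing \<delta> B P" for \<delta> P
    using assms unfolding is_packing_def by fast
  then have "packing_premeasure_scale s \<delta> A \<le> packing_premeasure_scale s \<delta> B" for \<delta>
    unfolding packing_premeasure_scale_def by (intro SUP_subset_mono) auto
  then show ?thesis
    unfolding packing_premeasure_def by (intro INF_mono) auto
qed

text \<open>
  A family of equal balls with centres in \<open>A\<close> is a packing as soon as the centres are more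
  than \<open>2 * r\<close> apart, so the premeasure bounds the size of \<open>2 * r\<close>-separated subsets. A separated subset
  of maximal size is a \<open>2 * r\<close>-net. Thus finite \<open>s\<close>-dimensional premeasure forces upper box
  dimension at most \<open>s\<close>.
\<close>

lemma finite_premeasure_imp_covering_bound:
  fixes A :: "'a::euclidean_space set"
  assumes "packing_premeasure s A < \<infinity>"
  obtains \<delta> M :: real where "\<delta> > 0" "M \<ge> 0"
    "\<And>r. 0 < r \<Longrightarrow> r \<le> \<delta> \<Longrightarrow>
       \<exists>C. finite C \<and> C \<subseteq> A \<and> real (card C) \<le> M * (2 * r) powr (- s) \<and> A \<subseteq> (\<Union>c\<in>C. cball c (2 * r))"
proof -
  obtain \<delta> :: real where \<delta>: "\<delta> > 0" "packing_premeasure_scale s \<delta> A < \<infinity>"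
    using assms unfolding packing_premeasure_def INF_less_iff by auto
  then obtain M where M: "M \<ge> 0" "packing_premeasure_scale s \<delta> A = ennreal M"
    by (metis ennreal_cases less_irrefl infinity_ennreal_def)
  have "\<exists>C. finite C \<and> C \<subseteq> A \<and> real (card C) \<le> M * (2 * r) powr (- s) \<and> A \<subseteq> (\<Union>c\<in>C. cball c (2 * r))"
    if r: "0 < r" "r \<le> \<delta>" for r
  proof -
    define sep where "sep C \<longleftrightarrow> finite C \<and> C \<subseteq> A \<and> pairwise (\<lambda>x y. dist x y > 2 * r) C" for C
    have bound: "real (card C) \<le> M * (2 * r) powr (- s)" if "sep C" for C
    proof -
      let ?P = "(\<lambda>c. (c, r)) ` C"
      have fin: "finite C" using that by (simp add: sep_def)
      have inj: "inj_on (\<lambda>c. (c, r)) C" by (simp add: inj_on_def)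
      have disj: "cball x r \<inter> cball y r = {}" if "2 * r < dist x y" for x y :: 'a
      proof -
        have False if "z \<in> cball x r" "z \<in> cball y r" for z
          using that \<open>2 * r < dist x y\<close> dist_triangle2[of x y z] by (simp add: dist_commute)
        then show ?thesis by blast
      qed
      have "is_packing \<delta> A ?P"
        unfolding is_packing_def disjoint_family_on_def
        using that r fin disj by (auto simp: sep_def pairwise_def intro: countable_finite)
      then have "(\<Sum>\<^sub>\<infinity>(x, r) \<in> ?P. ennreal ((2 * r) powr s)) \<le> ennreal M"
        unfolding M(2)[symmetric] packing_premeasure_scale_def by (intro SUP_upper) simp
      also have "(\<Sum>\<^sub>\<infinity>(x, r) \<in> ?P. ennreal ((2 * r) powr s)) = ennreal (real (card C) * (2 * r) powr s)"
        using fin inj by (simp add: infsum_finite sum.reindex ennreal_mult ennreal_of_nat_eq_real_of_nat)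
      finally have "real (card C) * (2 * r) powr s \<le> M"
        using M(1) by simp
      then show ?thesis
        using r by (simp add: powr_minus field_simps)
    qed
    have "\<exists>C. sep C \<and> (\<forall>D. sep D \<longrightarrow> card D \<le> card C)"
    proof (rule ex_has_greatest_nat[of sep "{}" card "Suc (nat \<lceil>M * (2 * r) powr (- s)\<rceil>)"])
      show "sep {}" by (simp add: sep_def)
      show "\<forall>D. sep D \<longrightarrow> card D < Suc (nat \<lceil>M * (2 * r) powr (- s)\<rceil>)"
        using bound real_nat_ceiling_ge unfolding less_Suc_eq_le by (meson of_nat_le_iff order_trans)
    qed
    then obtain C where C: "sep C" "\<And>D. sep D \<Longrightarrow> card D \<le> card C" by blast
    have "A \<subseteq> (\<Union>c\<in>C. cball c (2 * r))"
    proof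
      fix x assume x: "x \<in> A"
      show "x \<in> (\<Union>c\<in>C. cball c (2 * r))"
      proof (rule ccontr)
        assume n: "x \<notin> (\<Union>c\<in>C. cball c (2 * r))"
        then have "x \<notin> C" using r by auto
        moreover have "sep (insert x C)"
          using C(1) x n by (auto simp: sep_def pairwise_insert dist_commute not_le)
        ultimately show False
          using C(1) C(2)[of "insert x C"] by (simp add: sep_def)
      qed
    qed
    then show ?thesis using C(1) bound[of C] by (auto simp: sep_def)
  qed
  then show ?thesis using that \<delta>(1) M(1) by blast
qed

section \<open>Quotients of a set of small packing dimension\<close>

lemma quotient_close:
  fixes x y c d K r :: real
  assumes K: "K > 0" and "1 / K \<le> \<bar>y\<bar>" "1 / K \<le> \<bar>d\<bar>" "\<bar>c\<bar> \<le> K" "\<bar>d\<bar> \<le> K"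
    and "\<bar>x - c\<bar> \<le> r" "\<bar>y - d\<bar> \<le> r"
  shows "\<bar>x / y - c / d\<bar> \<le> 2 * K ^ 3 * r"
proof -
  have "1 / K > 0" using K by simp
  then have nz: "y \<noteq> 0" "d \<noteq> 0" using assms(2,3) by auto
  have r: "r \<ge> 0" using assms(6) by linarith
  have "x / y - c / d = ((x - c) * d - c * (y - d)) * (1 / y * (1 / d))"
    using nz by (simp add: field_simps)
  then have "\<bar>x / y - c / d\<bar> = \<bar>(x - c) * d - c * (y - d)\<bar> * (1 / \<bar>y\<bar> * (1 / \<bar>d\<bar>))"
    by (simp add: abs_mult)
  also have "\<dots> \<le> (2 * K * r) * (K * K)"
  proof (intro mult_mono)
    have "\<bar>(x - c) * d - c * (y - d)\<bar> \<le> \<bar>x - c\<bar> * \<bar>d\<bar> + \<bar>c\<bar> * \<bar>y - d\<bar>"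
      unfolding abs_mult[symmetric] by (rule abs_triangle_ineq4)
    also have "\<dots> \<le> r * K + K * r"
      using assms r by (intro add_mono mult_mono) auto
    finally show "\<bar>(x - c) * d - c * (y - d)\<bar> \<le> 2 * K * r"
      by simp
    show "1 / \<bar>y\<bar> \<le> K" "1 / \<bar>d\<bar> \<le> K"
      using assms nz by (auto simp: field_simps)
  qed (use K r in auto)
  finally show ?thesis by (simp add: power3_eq_cube algebra_simps)
qed

text \<open>
  Covering both sets at the scale \<open>r\<close> covers the quotients by as many intervals as there are pairs of
  centres, with total length of order \<open>r powr (1 - 2 * s)\<close>. The exponent is positive
  exactly because \<open>s < 1 / 2\<close>.
\<close>

lemma negligible_quotients:
  fixes A B :: "real set"
  assumes A: "packing_premeasure s A < \<infinity>" and B: "packing_premeasure s B < \<infinity>"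
    and s: "s < 1 / 2" and K: "K > 0"
    and AK: "\<And>x. x \<in> A \<Longrightarrow> \<bar>x\<bar> \<le> K"
    and BK: "\<And>y. y \<in> B \<Longrightarrow> 1 / K \<le> \<bar>y\<bar> \<and> \<bar>y\<bar> \<le> K"
  shows "negligible {x / y | x y. x \<in> A \<and> y \<in> B}" (is "negligible ?Q")
proof -
  from finite_premeasure_imp_covering_bound[OF A] obtain \<delta>1 M where M: "\<delta>1 > 0" "M \<ge> 0"
    "\<And>r. 0 < r \<Longrightarrow> r \<le> \<delta>1 \<Longrightarrow>
       \<exists>C. finite C \<and> C \<subseteq> A \<and> real (card C) \<le> M * (2 * r) powr (- s) \<and> A \<subseteq> (\<Union>c\<in>C. cball c (2 * r))"
    by metis
  from finite_premeasure_imp_covering_bound[OF B] obtain \<delta>2 N where N: "\<delta>2 > 0" "N \<ge> 0"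
    "\<And>r. 0 < r \<Longrightarrow> r \<le> \<delta>2 \<Longrightarrow>
       \<exists>C. finite C \<and> C \<subseteq> B \<and> real (card C) \<le> N * (2 * r) powr (- s) \<and> B \<subseteq> (\<Union>c\<in>C. cball c (2 * r))"
    by metis
  define g where "g r = 4 * K ^ 3 * M * N * (2 * r) powr (1 - 2 * s)" for r
  have cover: "\<exists>T. ?Q \<subseteq> T \<and> T \<in> lmeasurable \<and> measure lebesgue T \<le> g r"
    if r: "0 < r" "r \<le> min \<delta>1 \<delta>2" for r
  proof -
    obtain C where C: "finite C" "C \<subseteq> A" "real (card C) \<le> M * (2 * r) powr (- s)"
        "A \<subseteq> (\<Union>c\<in>C. cball c (2 * r))"
      using M(3)[of r] r by auto
    obtain D where D: "finite D" "D \<subseteq> B" "real (card D) \<le> N * (2 * r) powr (- s)"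
        "B \<subseteq> (\<Union>c\<in>D. cball c (2 * r))"
      using N(3)[of r] r by auto
    define \<rho> where "\<rho> = 2 * K ^ 3 * (2 * r)"
    have \<rho>: "\<rho> \<ge> 0" using K r by (simp add: \<rho>_def)
    let ?T = "\<Union>(c, d)\<in>C \<times> D. cball (c / d) \<rho>"
    have "?Q \<subseteq> ?T"
    proof
      fix q assume "q \<in> ?Q"
      then obtain x y where q: "q = x / y" "x \<in> A" "y \<in> B" by blast
      then obtain c d where cd: "c \<in> C" "x \<in> cball c (2 * r)" "d \<in> D" "y \<in> cball d (2 * r)"
        using C(4) D(4) by blast
      then have "\<bar>x / y - c / d\<bar> \<le> \<rho>"
        unfolding \<rho>_def using q AK BK C(2) D(2) K
        by (intro quotient_close) (auto simp: dist_real_def abs_minus_commute)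
      then show "q \<in> ?T"
        using cd q by (force simp: dist_real_def abs_minus_commute)
    qed
    moreover have "?T \<in> lmeasurable"
      using C(1) D(1) by (intro fmeasurable.finite_UN) auto
    moreover have "measure lebesgue ?T \<le> g r"
    proof -
      have "measure lebesgue ?T \<le> (\<Sum>p\<in>C \<times> D. measure lebesgue (case p of (c, d) \<Rightarrow> cball (c / d) \<rho>))"
        using C(1) D(1) by (intro measure_UNION_le) auto
      also have "\<dots> = (\<Sum>p\<in>C \<times> D. 2 * \<rho>)"
        using \<rho> by (intro sum.cong) (auto simp: cball_eq_atLeastAtMost)
      also have "\<dots> = 2 * \<rho> * (real (card C) * real (card D))"
        by (simp add: card_cartesian_product)
      also have "\<dots> \<le> 2 * \<rho> * ((M * (2 * r) powr (- s)) * (N * (2 * r) powr (- s)))"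
        using C(3) D(3) \<rho> M(2) by (intro mult_left_mono mult_mono) auto
      also have "\<dots> = 4 * K ^ 3 * M * N * ((2 * r) powr 1 * (2 * r) powr (- s) * (2 * r) powr (- s))"
        using r by (simp add: \<rho>_def)
      also have "\<dots> = g r"
        unfolding powr_add[symmetric] g_def by (simp add: algebra_simps)
      finally show ?thesis .
    qed
    ultimately show ?thesis by blast
  qed
  \<comment> \<open>At \<open>r = 0\<close> the power is \<open>0 powr (1 - 2 * s) = 0\<close>; the limit from the right agrees with it as \<open>1 - 2 * s > 0\<close>.\<close>
  have "(g \<longlongrightarrow> 4 * K ^ 3 * M * N * 0) (at_right 0)"
    unfolding g_def
  proof (intro tendsto_mult tendsto_const)
    have "((\<lambda>r. (2 * r) powr (1 - 2 * s)) \<longlongrightarrow> (2 * 0) powr (1 - 2 * s)) (at_right (0::real))"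
      using s by (intro tendsto_powr' tendsto_intros) (auto simp: eventually_at_filter)
    then show "((\<lambda>r. (2 * r) powr (1 - 2 * s)) \<longlongrightarrow> 0) (at_right (0::real))"
      by simp
  qed
  then have lim: "(g \<longlongrightarrow> 0) (at_right 0)" by simp
  show ?thesis
    unfolding negligible_outer_le
  proof (intro allI impI)
    fix e :: real assume "e > 0"
    then have "\<forall>\<^sub>F r in at_right 0. g r < e"
      using lim by (simp add: order_tendstoD)
    moreover have "\<forall>\<^sub>F r in at_right 0. r \<in> {0<..<min \<delta>1 \<delta>2}"
      using M(1) N(1) by (intro eventually_at_right_real) auto
    ultimately have "\<forall>\<^sub>F r in at_right 0. g r < e \<and> r \<in> {0<..<min \<delta>1 \<delta>2}"
      by (rule eventually_conj)
    then obtain r where "g r < e" "0 < r" "r < min \<delta>1 \<delta>2"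
      by (auto dest!: eventually_happens)
    moreover from this obtain T where "?Q \<subseteq> T" "T \<in> lmeasurable" "measure lebesgue T \<le> g r"
      using cover[of r] by auto
    ultimately show "\<exists>T. ?Q \<subseteq> T \<and> T \<in> lmeasurable \<and> measure lebesgue T \<le> e"
      by (intro exI[of _ T]) simp
  qed
qed

text \<open>
  The packing measure is defined by countable covers with pieces of finite premeasure. The pieces
  are truncated further, to numbers bounded above and, for denominators, away from 0, where
  division is Lipschitz.
\<close>

lemma negligible_nonzero_quotients_if_packing_dim_less_half:
  fixes E :: "real set"
  assumes "packing_dim E < 1 / 2"
  shows "negligible {x / y | x y. x \<in> E \<and> y \<in> E \<and> y \<noteq> 0}" (is "negligible ?Q")
proof -
  have half: "(1 / 2 :: ereal) = ereal (1 / 2)"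
    by (simp add: divide_ereal_def)
  obtain s where s: "s < 1 / 2" "packing_measure s E = 0"
    using assms unfolding packing_dim_def INF_less_iff half by auto
  then have "packing_measure s E < \<infinity>" by simp
  then obtain F :: "nat \<Rightarrow> real set" where F: "E \<subseteq> (\<Union>n. F n)" "(\<Sum>n. packing_premeasure s (F n)) < \<infinity>"
    unfolding packing_measure_def INF_less_iff by blast
  have fin: "packing_premeasure s (F n) < \<infinity>" for n
  proof -
    have "sum (\<lambda>n. packing_premeasure s (F n)) {n} \<le> (\<Sum>n. packing_premeasure s (F n))"
      by (rule sum_le_suminf) auto
    then show ?thesis using F(2) by simp
  qed
  define A where "A n k = F n \<inter> {x. \<bar>x\<bar> \<le> real (Suc k)}" for n k
  define B where "B n k = F n \<inter> {y. 1 / real (Suc k) \<le> \<bar>y\<bar> \<and> \<bar>y\<bar> \<le> real (Suc k)}" for n k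
  have "negligible {x / y | x y. x \<in> A m k \<and> y \<in> B n k}" for m n k
  proof (rule negligible_quotients[OF _ _ s(1), of _ _ "real (Suc k)"])
    show "packing_premeasure s (A m k) < \<infinity>"
      using packing_premeasure_mono[of "A m k" "F m" s] fin[of m] by (simp add: A_def)
    show "packing_premeasure s (B n k) < \<infinity>"
      using packing_premeasure_mono[of "B n k" "F n" s] fin[of n] by (simp add: B_def)
  qed (auto simp: A_def B_def)
  then have "negligible (\<Union>m. \<Union>n. \<Union>k. {x / y | x y. x \<in> A m k \<and> y \<in> B n k})"
    by (intro negligible_Union_nat)
  moreover have "?Q \<subseteq> (\<Union>m. \<Union>n. \<Union>k. {x / y | x y. x \<in> A m k \<and> y \<in> B n k})"
  proof
    fix q assume "q \<in> ?Q"
    then obtain x y where q: "q = x / y" "x \<in> E" "y \<in> E" "y \<noteq> 0" by blast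
    then obtain m n where mn: "x \<in> F m" "y \<in> F n" using F(1) by blast
    obtain k where "max \<bar>x\<bar> (max \<bar>y\<bar> (1 / \<bar>y\<bar>)) \<le> real k"
      using real_arch_simple by blast
    then have k: "\<bar>x\<bar> \<le> real (Suc k)" "\<bar>y\<bar> \<le> real (Suc k)" "1 / \<bar>y\<bar> \<le> real (Suc k)"
      by auto
    then have "1 / real (Suc k) \<le> \<bar>y\<bar>"
      using q(4) by (simp add: field_simps)
    then have "x \<in> A m k" "y \<in> B n k" using mn k by (auto simp: A_def B_def)
    then show "q \<in> (\<Union>m. \<Union>n. \<Union>k. {x / y | x y. x \<in> A m k \<and> y \<in> B n k})"
      using q(1) by blast
  qed
  ultimately show ?thesis by (rule negligible_subset)
qed

section \<open>Combs and dense dilations\<close>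

definition comb :: "real \<Rightarrow> real \<Rightarrow> real set" where
  "comb \<mu> \<delta> = (\<Union>k. {\<mu> * real_of_int k <..< \<mu> * (real_of_int k + \<delta>)})"

text \<open>
  Up to the scaling by \<open>\<mu>\<close>, a term lies in the comb when its fractional part is within \<open>\<delta> / 2\<close> of the centre
  \<open>\<delta> / 2\<close> of a tooth. Density of the untranslated fractional parts near
  \<open>\<delta> / 2 - t / \<mu>\<close> modulo 1 provides such a term.
\<close>

lemma dense_dilation_meets_comb:
  assumes x: "x / \<mu> \<notin> non_dense_dilations a" and "\<mu> > 0" "\<delta> > 0"
  shows "\<exists>n. x * a n + t \<in> comb \<mu> \<delta>"
proof -
  define p where "p = frac (\<delta> / 2 - t / \<mu>)"
  have "p \<in> {0..<1}" by (simp add: p_def frac_lt_1)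
  then have "p \<in> closure (range (\<lambda>n. frac (x / \<mu> * a n)))"
    using x unfolding non_dense_dilations_def by blast
  then obtain n where n: "\<bar>frac (x / \<mu> * a n) - p\<bar> < \<delta> / 2"
    using \<open>\<delta> > 0\<close> unfolding closure_approachable by (auto simp: dist_real_def dest!: spec[of _ "\<delta> / 2"])
  define k where "k = \<lfloor>x / \<mu> * a n\<rfloor> - \<lfloor>\<delta> / 2 - t / \<mu>\<rfloor>"
  define y where "y = x / \<mu> * a n + t / \<mu>"
  have "\<bar>y - \<delta> / 2 - k\<bar> < \<delta> / 2"
    using n by (simp add: p_def frac_def k_def y_def algebra_simps)
  then have "k < y" "y < k + \<delta>" by linarith+
  then have "\<mu> * k < \<mu> * y" "\<mu> * y < \<mu> * (k + \<delta>)" using \<open>\<mu> > 0\<close> by auto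
  moreover have "\<mu> * y = x * a n + t" using \<open>\<mu> > 0\<close> by (simp add: y_def distrib_left)
  ultimately show ?thesis by (auto simp: comb_def)
qed

lemma open_comb: "open (comb \<mu> \<delta>)"
  unfolding comb_def by auto

text \<open>
  At most \<open>2 / \<mu> + 2\<close> teeth meet a window of length 2, each of length \<open>\<mu> * \<delta>\<close>. As \<open>\<mu> \<le> 1\<close>, the bound does
  not depend on \<open>\<mu>\<close>, so \<open>\<delta>\<close> can be chosen in terms of \<open>\<epsilon>\<close> alone.
\<close>

lemma measure_comb_le:
  assumes \<mu>: "0 < \<mu>" "\<mu> \<le> 1" and \<delta>: "0 < \<delta>" "\<delta> \<le> 1"
  shows "measure lebesgue (comb \<mu> \<delta> \<inter> {p - 1..p + 1}) \<le> 4 * \<delta>"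
proof -
  let ?K = "{\<lfloor>(p - 1) / \<mu>\<rfloor>..\<lfloor>(p + 1) / \<mu>\<rfloor>}"
  let ?J = "\<lambda>k::int. {\<mu> * k <..< \<mu> * (k + \<delta>)}"
  have sub: "comb \<mu> \<delta> \<inter> {p - 1..p + 1} \<subseteq> (\<Union>k\<in>?K. ?J k)"
  proof
    fix y assume y: "y \<in> comb \<mu> \<delta> \<inter> {p - 1..p + 1}"
    then obtain k :: int where k: "\<mu> * k < y" "y < \<mu> * (k + \<delta>)" by (auto simp: comb_def)
    have "\<mu> * (k + \<delta>) \<le> \<mu> * (k + 1)" using \<mu> \<delta> by simp
    then have "p - 1 < \<mu> * (k + 1)" "\<mu> * k < p + 1"
      using k y by auto
    then have "(p - 1) / \<mu> < k + 1" "k < (p + 1) / \<mu>"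
      using \<mu> by (auto simp: field_simps)
    then have "k \<in> ?K"
      by (simp add: le_floor_iff floor_le_iff)
    then show "y \<in> (\<Union>k\<in>?K. ?J k)" using k by auto
  qed
  have len: "measure lebesgue (?J k) = \<mu> * \<delta>" for k
    using \<mu> \<delta> by (simp add: algebra_simps)
  have "measure lebesgue (comb \<mu> \<delta> \<inter> {p - 1..p + 1}) \<le> measure lebesgue (\<Union>k\<in>?K. ?J k)"
    by (intro measure_mono_fmeasurable sub fmeasurable.finite_UN)
       (auto intro!: sets.Int borel_open open_comb sets_completionI_sets)
  also have "\<dots> \<le> (\<Sum>k\<in>?K. measure lebesgue (?J k))"
    by (intro measure_UNION_le) auto
  also have "\<dots> = real (card ?K) * (\<mu> * \<delta>)"
    by (simp only: len) simp
  also have "\<dots> \<le> (2 / \<mu> + 2) * (\<mu> * \<delta>)"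
  proof (rule mult_right_mono)
    have "(p - 1) / \<mu> \<le> (p + 1) / \<mu>" using \<mu> by (simp add: divide_right_mono)
    then have "\<lfloor>(p - 1) / \<mu>\<rfloor> \<le> \<lfloor>(p + 1) / \<mu>\<rfloor>" by (rule floor_mono)
    moreover have "(p + 1) / \<mu> = (p - 1) / \<mu> + 2 / \<mu>"
      by (simp add: add_divide_distrib[symmetric])
    ultimately show "real (card ?K) \<le> 2 / \<mu> + 2"
      by simp linarith
  qed (use \<mu> \<delta> in auto)
  also have "\<dots> = (2 + 2 * \<mu>) * \<delta>" using \<mu> by (simp add: field_simps)
  also have "\<dots> \<le> 4 * \<delta>" using \<mu> \<delta> by (intro mult_right_mono) auto
  finally show ?thesis .
qed

section \<open>Largeness of the complement of two combs\<close>

text \<open>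
  An interval of measure 1 may be open, closed or half-open. Enclosing it in a window of length 2 centred at
  one of its points avoids the distinction, at the cost of a factor 2 in the thickness of the combs.
\<close>

lemma interval_of_measure_1_bounded:
  fixes I :: "real set"
  assumes I: "is_interval I" "measure lebesgue I = 1"
  shows "I \<in> lmeasurable" and "\<exists>p. I \<subseteq> {p - 1..p + 1}"
proof -
  have "emeasure lebesgue I \<noteq> \<infinity>"
    using I(2) by (auto simp: measure_def)
  moreover have "I \<in> sets lebesgue"
    using I(1) by (simp add: real_interval_borel_measurable sets_completionI_sets)
  ultimately show meas: "I \<in> lmeasurable"
    by (simp add: fmeasurableI2 fmeasurable_def less_top)
  have "I \<noteq> {}" using I(2) by auto
  then obtain p where p: "p \<in> I" by blast
  have "v - u \<le> 1" if "u \<in> I" "v \<in> I" "u \<le> v" for u v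
  proof -
    have "{u..v} \<subseteq> I"
      using I(1) that unfolding is_interval_1 by (meson atLeastAtMost_iff subsetI)
    then have "measure lebesgue {u..v} \<le> measure lebesgue I"
      by (intro measure_mono_fmeasurable meas) auto
    then show ?thesis using that I(2) by simp
  qed
  then have "I \<subseteq> {p - 1..p + 1}" using p by (smt (verit) atLeastAtMost_iff subsetI)
  then show "\<exists>p. I \<subseteq> {p - 1..p + 1}" by blast
qed

text \<open>
  Each comb of thickness \<open>\<delta>\<close> removes at most \<open>4 * \<delta>\<close> from the window, hence \<open>\<delta> = \<epsilon> / 8\<close> for two combs.
\<close>

lemma large_set_Compl_combs:
  assumes \<mu>: "0 < \<mu>" "\<mu> \<le> 1" and \<epsilon>: "0 < \<epsilon>" "\<epsilon> \<le> 1"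
  shows "large_set (1 - \<epsilon>) (- (comb 1 (\<epsilon> / 8) \<union> comb \<mu> (\<epsilon> / 8)))"
proof -
  let ?G = "comb 1 (\<epsilon> / 8)" and ?H = "comb \<mu> (\<epsilon> / 8)"
  have GH: "?G \<in> sets lebesgue" "?H \<in> sets lebesgue"
    using open_comb by (auto intro: sets_completionI_sets)
  have "1 - \<epsilon> \<le> measure lebesgue (- (?G \<union> ?H) \<inter> I)"
    if I: "is_interval I" "measure lebesgue I = 1" for I
  proof -
    have meas: "I \<in> lmeasurable" by (rule interval_of_measure_1_bounded[OF I])
    obtain p where p: "I \<subseteq> {p - 1..p + 1}"
      using interval_of_measure_1_bounded[OF I] by blast
    let ?W = "{p - 1..p + 1}"
    have GHW: "?G \<inter> ?W \<in> lmeasurable" "?H \<inter> ?W \<in> lmeasurable"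
      using GH by (auto intro!: fmeasurable_Int_fmeasurable simp: Int_commute)
    have "1 = measure lebesgue I" using I by simp
    also have "\<dots> \<le> measure lebesgue ((- (?G \<union> ?H) \<inter> I) \<union> ((?G \<inter> ?W) \<union> (?H \<inter> ?W)))"
    proof (rule measure_mono_fmeasurable)
      show "- (?G \<union> ?H) \<inter> I \<union> (?G \<inter> ?W \<union> ?H \<inter> ?W) \<in> lmeasurable"
        using GHW GH meas by (intro fmeasurable.Un) (auto intro!: fmeasurable_Int_fmeasurable simp: Int_commute)
    qed (use p meas in auto)
    also have "\<dots> \<le> measure lebesgue (- (?G \<union> ?H) \<inter> I) + measure lebesgue ((?G \<inter> ?W) \<union> (?H \<inter> ?W))"
      using GHW GH meas by (intro measure_Un_le) (auto simp: fmeasurableD)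
    also have "measure lebesgue ((?G \<inter> ?W) \<union> (?H \<inter> ?W)) \<le> measure lebesgue (?G \<inter> ?W) + measure lebesgue (?H \<inter> ?W)"
      using GHW by (intro measure_Un_le) (auto simp: fmeasurableD)
    also have "\<dots> \<le> 4 * (\<epsilon> / 8) + 4 * (\<epsilon> / 8)"
      using \<mu> \<epsilon> by (intro add_mono measure_comb_le) auto
    finally show ?thesis by simp
  qed
  then show ?thesis
    using GH unfolding large_set_def by auto
qed

section \<open>A large set without affine copies\<close>

theorem theorem1p3:
  fixes a :: "nat \<Rightarrow> real"
  assumes "packing_dim (non_dense_dilations a) < 1 / 2"
  shows "\<forall>\<epsilon>::real. 0 < \<epsilon> \<and> \<epsilon> \<le> 1 \<longrightarrow>
    (\<exists>S. large_set (1 - \<epsilon>) S \<and> (\<forall>C. is_affine_copy a C \<longrightarrow> \<not> C \<subseteq> S))"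
proof (intro allI impI)
  fix \<epsilon> :: real assume \<epsilon>: "0 < \<epsilon> \<and> \<epsilon> \<le> 1"
  let ?E = "non_dense_dilations a"
  let ?Q = "{x / y | x y. x \<in> ?E \<and> y \<in> ?E \<and> y \<noteq> 0}"
  have "negligible ?Q"
    using assms by (rule negligible_nonzero_quotients_if_packing_dim_less_half)
  moreover have "\<not> negligible {0<..<1::real}"
    by (rule open_not_negligible) auto
  ultimately have "\<not> {0<..<1} \<subseteq> ?Q"
    using negligible_subset by blast
  then obtain \<mu> :: real where "\<mu> \<in> {0<..<1}" and \<mu>_nq: "\<mu> \<notin> ?Q" by blast
  then have \<mu>: "0 < \<mu>" "\<mu> < 1" by simp_all
  let ?S = "- (comb 1 (\<epsilon> / 8) \<union> comb \<mu> (\<epsilon> / 8))"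
  have "\<not> C \<subseteq> ?S" if copy: "is_affine_copy a C" for C
  proof -
    obtain x t where x: "x \<noteq> 0" "C = range (\<lambda>n. x * a n + t)"
      using copy unfolding is_affine_copy_def by blast
    \<comment> \<open>If both ratios were bad, \<open>\<mu>\<close> would be their quotient.\<close>
    have "x / 1 \<notin> ?E \<or> x / \<mu> \<notin> ?E"
    proof (rule ccontr)
      assume "\<not> ?thesis"
      then have "x \<in> ?E" "x / \<mu> \<in> ?E" "x / \<mu> \<noteq> 0" "\<mu> = x / (x / \<mu>)"
        using x \<mu> by auto
      then have "\<mu> \<in> ?Q" by (intro CollectI exI[of _ x] exI[of _ "x / \<mu>"] conjI)
      then show False using \<mu>_nq by contradiction
    qed
    then have "\<exists>n. x * a n + t \<in> comb 1 (\<epsilon> / 8) \<union> comb \<mu> (\<epsilon> / 8)"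
      using dense_dilation_meets_comb[of x 1 a "\<epsilon> / 8" t] dense_dilation_meets_comb[of x \<mu> a "\<epsilon> / 8" t] \<mu> \<epsilon>
      by (metis UnCI less_numeral_extra(1) zero_less_divide_iff zero_less_numeral)
    then show ?thesis unfolding x(2) by (auto simp: image_subset_iff)
  qed
  moreover have "large_set (1 - \<epsilon>) ?S"
    using \<mu> \<epsilon> by (intro large_set_Compl_combs) auto
  ultimately show "\<exists>S. large_set (1 - \<epsilon>) S \<and> (\<forall>C. is_affine_copy a C \<longrightarrow> \<not> C \<subseteq> S)"
    by blast
qed

end
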